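(* Let $(X,d)$ be a compact metric space, $f_{0,\infty}=\{f_n\}_{n=0}^{\infty}$ a sequence of continuous self-maps of $X$, and $n\ge1$ an integer. If $(\mathcal F^1(X),\tilde f_{0,\infty})$ is chain weakly mixing of order $n$, then so is $(\mathcal K(X),\bar f_{0,\infty})$. If $(\mathcal K(X),\bar f_{0,\infty})$ is chain weakly mixing of order $n$, then so is $(X,f_{0,\infty})$.
   Context: Induced systems: $\mathcal K(X)$ is the set of nonempty compact subsets of $X$ with the Hausdorff metric $D_X$; $\bar f_{0,\infty}=\{\bar f_n\}$, $\bar f_n(A)=f_n(A)$. For upper semicontinuous $u:X\to[0,1]$ let $[u]_\alpha=\{x:u(x)\ge\alpha\}$ for $\alpha\in(0,1]$ and $[u]_0=\overline{\{x:u(x)>0\}}$. $\mathcal F^1(X)$ is the set of upper semicontinuous $u:X\to[0,1]$ with $[u]_\alpha\in\mathcal K(X)$ for all $\alpha\in[0,1]$, with metric $d_\infty(u,v)=\sup_{\alpha\in(0,1]}D_X([u]_\alpha,[v]_\alpha)$. $\tilde f_{0,\infty}=\{\tilde f_n\}$ where $\tilde f_n(u)(x)=\sup_{z\in f_n^{-1}(x)}u(z)$ if $f_n^{-1}(x)\ne\emptyset$, and $0$ otherwise. Chain notions, for a metric space $(Y,\rho)$ with a sequence of continuous self-maps $g_{0,\infty}=\{g_i\}_{i\ge0}$: a $\delta$-chain of length $m$ from $x$ to $y$ is a finite sequence $x=x_0,x_1,\dots,x_m=y$ with $\rho(g_i(x_i),x_{i+1})<\delta$ for $0\le i\le m-1$.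 $(Y,g_{0,\infty})$ is chain transitive if for all $x,y\in Y$ and $\epsilon>0$ there is an $\epsilon$-chain from $x$ to $y$. It is chain weakly mixing of order $n$ if $(Y^n,g_{0,\infty}^{(n)})$ is chain transitive, where $Y^n$ carries the max product metric and $g_{0,\infty}^{(n)}=\{g_i\times\cdots\times g_i\}_{i\ge0}$ ($n$ factors). *)

theory Defs
  imports "HOL-Analysis.Analysis"
begin

section \<open>Hyperspace and fuzzy sets of a metric space\<close>

definition compact_hyperspace :: "'a::metric_space set set" where
  "compact_hyperspace = {A. compact A \<and> A \<noteq> {}}"

definition hausdorff_metric :: "'a::metric_space set \<Rightarrow> 'a set \<Rightarrow> real" where
  "hausdorff_metric A B = max (SUP a\<in>A. infdist a B) (SUP b\<in>B. infdist b A)"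

definition upper_semicontinuous :: "('a::topological_space \<Rightarrow> real) \<Rightarrow> bool" where
  "upper_semicontinuous u \<longleftrightarrow> (\<forall>x c. u x < c \<longrightarrow> (\<forall>\<^sub>F y in nhds x. u y < c))"

definition level_set :: "('a::topological_space \<Rightarrow> real) \<Rightarrow> real \<Rightarrow> 'a set" where
  "level_set u \<alpha> = (if \<alpha> = 0 then closure {x. u x > 0} else {x. u x \<ge> \<alpha>})"

definition fuzzy_space :: "('a::metric_space \<Rightarrow> real) set" where
  "fuzzy_space = {u. range u \<subseteq> {0..1} \<and> upper_semicontinuous u \<and>
     (\<forall>\<alpha>\<in>{0..1}. level_set u \<alpha> \<in> compact_hyperspace)}"

definition fuzzy_metric :: "('a::metric_space \<Rightarrow> real) \<Rightarrow> ('a \<Rightarrow> real) \<Rightarrow> real" where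
  "fuzzy_metric u v = (SUP \<alpha>\<in>{0<..1}. hausdorff_metric (level_set u \<alpha>) (level_set v \<alpha>))"

definition fuzzy_extension :: "('a \<Rightarrow> 'a) \<Rightarrow> ('a \<Rightarrow> real) \<Rightarrow> 'a \<Rightarrow> real" where
  "fuzzy_extension f u x = (if f -` {x} \<noteq> {} then (SUP z\<in>f -` {x}. u z) else 0)"

section \<open>Chains in nonautonomous systems\<close>

text \<open>A system is given by a carrier \<open>Y\<close>, a distance function \<open>\<rho>\<close> on it and a sequence
  \<open>g\<close> of self-maps. The map applied at step \<open>i\<close> is \<open>g i\<close>, so every chain starts at time 0,
  and chains have positive length.\<close>

definition is_chain ::
  "'b set \<Rightarrow> ('b \<Rightarrow> 'b \<Rightarrow> real) \<Rightarrow> (nat \<Rightarrow> 'b \<Rightarrow> 'b) \<Rightarrow> real \<Rightarrow> nat \<Rightarrow> (nat \<Rightarrow> 'b) \<Rightarrow> 'b \<Rightarrow> 'b \<Rightarrow> bool"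
where
  "is_chain Y \<rho> g \<delta> m c x y \<longleftrightarrow>
     m \<ge> 1 \<and> c 0 = x \<and> c m = y \<and> (\<forall>i\<le>m. c i \<in> Y) \<and>
     (\<forall>i<m. \<rho> (g i (c i)) (c (Suc i)) < \<delta>)"

definition chain_transitive ::
  "'b set \<Rightarrow> ('b \<Rightarrow> 'b \<Rightarrow> real) \<Rightarrow> (nat \<Rightarrow> 'b \<Rightarrow> 'b) \<Rightarrow> bool" where
  "chain_transitive Y \<rho> g \<longleftrightarrow>
     (\<forall>x\<in>Y. \<forall>y\<in>Y. \<forall>\<epsilon>>0. \<exists>m c. is_chain Y \<rho> g \<epsilon> m c x y)"

text \<open>Points of the \<open>n\<close>-fold product are functions on \<open>{..<n}\<close>, extended by \<open>undefined\<close>.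
  The maximum is only meaningful for \<open>n \<ge> 1\<close>.\<close>

definition power_carrier :: "nat \<Rightarrow> 'b set \<Rightarrow> (nat \<Rightarrow> 'b) set" where
  "power_carrier n Y = {..<n} \<rightarrow>\<^sub>E Y"

definition power_metric ::
  "nat \<Rightarrow> ('b \<Rightarrow> 'b \<Rightarrow> real) \<Rightarrow> (nat \<Rightarrow> 'b) \<Rightarrow> (nat \<Rightarrow> 'b) \<Rightarrow> real" where
  "power_metric n \<rho> x y = Max ((\<lambda>j. \<rho> (x j) (y j)) ` {..<n})"

definition power_map :: "nat \<Rightarrow> ('b \<Rightarrow> 'b) \<Rightarrow> (nat \<Rightarrow> 'b) \<Rightarrow> nat \<Rightarrow> 'b" where
  "power_map n h x = (\<lambda>j\<in>{..<n}. h (x j))"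

definition chain_weakly_mixing ::
  "nat \<Rightarrow> 'b set \<Rightarrow> ('b \<Rightarrow> 'b \<Rightarrow> real) \<Rightarrow> (nat \<Rightarrow> 'b \<Rightarrow> 'b) \<Rightarrow> bool" where
  "chain_weakly_mixing n Y \<rho> g \<longleftrightarrow>
     chain_transitive (power_carrier n Y) (power_metric n \<rho>) (\<lambda>i. power_map n (g i))"

end

theory Submission
  imports Defs
begin

text \<open>Both implications transport chains coordinatewise, with all coordinates keeping the same
  length. A fuzzy chain is sent to the chain of its level sets at \<open>\<alpha> = 1\<close>: compactness and upper
  semicontinuity give \<open>[f u]\<^sub>1 = f [u]\<^sub>1\<close>, and the indicator function of a compact set has that set
  as its level set. In a chain of compact sets between two singletons, one selects
  successively a point of each set that is close to the image of the preceding point.\<close>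

section \<open>Chains in a finite power, coordinate by coordinate\<close>

lemma power_metric_less_iff:
  assumes "n \<ge> 1"
  shows "power_metric n \<rho> x y < e \<longleftrightarrow> (\<forall>j<n. \<rho> (x j) (y j) < e)"
proof -
  have "(\<lambda>j. \<rho> (x j) (y j)) ` {..<n} \<noteq> {}" using assms by (auto simp: lessThan_empty_iff)
  then show ?thesis unfolding power_metric_def by (subst Max_less_iff) auto
qed

text \<open>The maximum metric and the product map are both read off coordinatewise. Fixing
  \<open>m\<close> outside both existentials records that the coordinate chains share one
  length.\<close>

lemma is_chain_power_iff:
  assumes "n \<ge> 1" "x \<in> power_carrier n Y" "y \<in> power_carrier n Y"
  shows "(\<exists>c. is_chain (power_carrier n Y) (power_metric n \<rho>) (\<lambda>i. power_map n (g i)) e m c x y)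
    \<longleftrightarrow> (\<exists>c. \<forall>j<n. is_chain Y \<rho> g e m (c j) (x j) (y j))" (is "?L \<longleftrightarrow> ?R")
proof
  assume ?L
  then obtain c where
    c: "is_chain (power_carrier n Y) (power_metric n \<rho>) (\<lambda>i. power_map n (g i)) e m c x y" ..
  have "is_chain Y \<rho> g e m (\<lambda>i. c i j) (x j) (y j)" if "j < n" for j
    using c that unfolding is_chain_def power_metric_less_iff[OF assms(1)]
    by (auto simp: power_carrier_def power_map_def PiE_iff)
  then show ?R by (intro exI[of _ "\<lambda>j i. c i j"]) blast
next
  assume ?R
  then obtain c where c: "\<And>j. j < n \<Longrightarrow> is_chain Y \<rho> g e m (c j) (x j) (y j)" by blast
  \<comment> \<open>These are equalities of functions: outside \<open>{..<n}\<close> both sides are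
    \<open>undefined\<close>.\<close>
  have ends: "(\<lambda>j\<in>{..<n}. c j 0) = x" "(\<lambda>j\<in>{..<n}. c j m) = y"
    using c assms(2,3) by (auto simp: is_chain_def power_carrier_def PiE_iff extensional_def fun_eq_iff)
  have "m \<ge> 1" using c[of 0] assms(1) by (simp add: is_chain_def)
  then have "is_chain (power_carrier n Y) (power_metric n \<rho>) (\<lambda>i. power_map n (g i)) e m
      (\<lambda>i. \<lambda>j\<in>{..<n}. c j i) x y"
    using c ends unfolding is_chain_def power_metric_less_iff[OF assms(1)]
    by (auto simp: power_carrier_def power_map_def)
  then show ?L by blast
qed

text \<open>Endpoints become arbitrary functions constrained only below \<open>n\<close>, so later
  arguments can avoid extensional functions.\<close>

lemma chain_weakly_mixing_iff:
  assumes "n \<ge> 1"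
  shows "chain_weakly_mixing n Y \<rho> g \<longleftrightarrow>
    (\<forall>x y e. (\<forall>j<n. x j \<in> Y \<and> y j \<in> Y) \<longrightarrow> e > 0 \<longrightarrow>
      (\<exists>m c. \<forall>j<n. is_chain Y \<rho> g e m (c j) (x j) (y j)))" (is "?L \<longleftrightarrow> ?R")
proof
  assume L: ?L
  show ?R
  proof (intro allI impI)
    fix x y :: "nat \<Rightarrow> 'a" and e :: real
    assume Y: "\<forall>j<n. x j \<in> Y \<and> y j \<in> Y" and e: "e > 0"
    define x' y' where "x' = restrict x {..<n}" and "y' = restrict y {..<n}"
    have mem: "x' \<in> power_carrier n Y" "y' \<in> power_carrier n Y"
      using Y by (auto simp: x'_def y'_def power_carrier_def)
    then obtain m where "\<exists>c. is_chain (power_carrier n Y) (power_metric n \<rho>)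
        (\<lambda>i. power_map n (g i)) e m c x' y'"
      using L e unfolding chain_weakly_mixing_def chain_transitive_def by blast
    then obtain c where "\<forall>j<n. is_chain Y \<rho> g e m (c j) (x' j) (y' j)"
      unfolding is_chain_power_iff[OF assms mem] by blast
    then show "\<exists>m c. \<forall>j<n. is_chain Y \<rho> g e m (c j) (x j) (y j)"
      by (auto simp: x'_def y'_def)
  qed
next
  assume R: ?R
  show ?L
    unfolding chain_weakly_mixing_def chain_transitive_def
  proof (intro ballI allI impI)
    fix x y :: "nat \<Rightarrow> 'a" and e :: real
    assume mem: "x \<in> power_carrier n Y" "y \<in> power_carrier n Y" and e: "e > 0"
    then have "\<forall>j<n. x j \<in> Y \<and> y j \<in> Y" by (auto simp: power_carrier_def)
    with R e show "\<exists>m c. is_chain (power_carrier n Y) (power_metric n \<rho>)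
        (\<lambda>i. power_map n (g i)) e m c x y"
      unfolding is_chain_power_iff[OF assms mem] by blast
  qed
qed

section \<open>Bounds that make the suprema in both metrics meaningful\<close>

lemma infdist_le_diameter:
  fixes A :: "'a::metric_space set"
  assumes "bounded (UNIV :: 'a set)"
  shows "infdist x A \<le> diameter (UNIV :: 'a set)"
proof (cases "A = {}")
  case True
  then show ?thesis using diameter_ge_0[OF assms] by (simp add: infdist_def)
next
  case False
  then obtain a where "a \<in> A" by blast
  then have "infdist x A \<le> dist x a" by (rule infdist_le)
  also have "\<dots> \<le> diameter (UNIV :: 'a set)"
    using diameter_bounded_bound[OF assms] by simp
  finally show ?thesis .
qed

lemma hausdorff_metric_le_diameter:
  fixes A B :: "'a::metric_space set"
  assumes "bounded (UNIV :: 'a set)" "A \<noteq> {}" "B \<noteq> {}"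
  shows "hausdorff_metric A B \<le> diameter (UNIV :: 'a set)"
  unfolding hausdorff_metric_def
  by (intro max.boundedI cSUP_least assms infdist_le_diameter)

lemma infdist_le_hausdorff_metric:
  fixes A B :: "'a::metric_space set"
  assumes "bounded (UNIV :: 'a set)" "a \<in> A"
  shows "infdist a B \<le> hausdorff_metric A B"
proof -
  have "bdd_above ((\<lambda>a. infdist a B) ` A)"
    using infdist_le_diameter[OF assms(1)] by (intro bdd_aboveI2)
  then have "infdist a B \<le> (SUP a\<in>A. infdist a B)" by (intro cSUP_upper assms)
  then show ?thesis unfolding hausdorff_metric_def by simp
qed

text \<open>The infimum defining \<open>infdist a B\<close> lies strictly below \<open>e\<close>, so
  some point of \<open>B\<close> already realizes a distance below \<open>e\<close>.\<close>

lemma hausdorff_metric_lessE: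
  fixes A B :: "'a::metric_space set"
  assumes "bounded (UNIV :: 'a set)" "hausdorff_metric A B < e" "a \<in> A" "B \<noteq> {}"
  obtains b where "b \<in> B" "dist a b < e"
proof -
  have "(INF b\<in>B. dist a b) < e"
    using infdist_le_hausdorff_metric[OF assms(1,3), of B] assms(2,4)
    by (simp add: infdist_def)
  moreover have "bdd_below (dist a ` B)" by (intro bdd_belowI2[of _ 0]) simp
  ultimately show ?thesis using cINF_less_iff[OF assms(4)] that by blast
qed

text \<open>Level sets grow as the level decreases, so nonemptiness at level 1 passes to all levels
  in (0,1], and the diameter bounds the family under the supremum. Asking only for nonemptiness lets
  this apply to \<open>fuzzy_extension f u\<close> without first placing it in
  \<open>fuzzy_space\<close>.\<close>

lemma hausdorff_metric_le_fuzzy_metric: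
  fixes u v :: "'a::metric_space \<Rightarrow> real"
  assumes "bounded (UNIV :: 'a set)" "level_set u 1 \<noteq> {}" "level_set v 1 \<noteq> {}"
    "\<alpha> \<in> {0<..1}"
  shows "hausdorff_metric (level_set u \<alpha>) (level_set v \<alpha>) \<le> fuzzy_metric u v"
  unfolding fuzzy_metric_def
proof (rule cSUP_upper[OF assms(4)], rule bdd_aboveI2)
  fix \<beta> :: real assume "\<beta> \<in> {0<..1}"
  then have "level_set w 1 \<subseteq> level_set w \<beta>" for w :: "'a \<Rightarrow> real"
    by (auto simp: level_set_def)
  with assms(2,3) have "level_set u \<beta> \<noteq> {}" "level_set v \<beta> \<noteq> {}" by blast+
  then show "hausdorff_metric (level_set u \<beta>) (level_set v \<beta>) \<le> diameter (UNIV :: 'a set)"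
    by (rule hausdorff_metric_le_diameter[OF assms(1)])
qed

section \<open>Compact sets as fuzzy sets\<close>

lemma upper_semicontinuous_indicator:
  assumes "closed A"
  shows "upper_semicontinuous (indicator A :: 'a::topological_space \<Rightarrow> real)"
  unfolding upper_semicontinuous_def
proof (intro allI impI)
  fix x :: 'a and c :: real
  assume c: "indicator A x < c"
  show "\<forall>\<^sub>F y in nhds x. indicator A y < c"
  proof (cases "x \<in> A")
    case True
    with c have "indicator A y < c" for y
      by (simp add: indicator_def)
    then show ?thesis by simp
  next
    case False
    then have "\<forall>\<^sub>F y in nhds x. y \<in> - A" using assms by (intro eventually_nhds_in_open) auto
    then show ?thesis by eventually_elim (use c False in simp)
  qed
qed

text \<open>At level 0 the level set is the closure of \<open>A\<close>, which is where closedness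
  enters.\<close>

lemma level_set_indicator:
  assumes "closed A" "0 \<le> \<alpha>" "\<alpha> \<le> 1"
  shows "level_set (indicator A) \<alpha> = A"
proof -
  have "{x. indicator A x > (0::real)} = A" by (auto simp: indicator_def)
  then show ?thesis using assms by (auto simp: level_set_def indicator_def split: if_splits)
qed

lemma indicator_in_fuzzy_space:
  assumes "A \<in> compact_hyperspace"
  shows "indicator A \<in> fuzzy_space"
proof -
  have "closed A" using assms by (auto simp: compact_hyperspace_def compact_imp_closed)
  then show ?thesis
    using assms upper_semicontinuous_indicator level_set_indicator[of A]
    by (auto simp: fuzzy_space_def indicator_def)
qed

section \<open>Level sets of the fuzzy extension\<close>

lemma upper_semicontinuous_attains_sup:
  fixes u :: "'a::topological_space \<Rightarrow> real"
  assumes u: "upper_semicontinuous u" and "compact K" "K \<noteq> {}"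
  shows "\<exists>z\<in>K. \<forall>x\<in>K. u x \<le> u z"
proof (rule ccontr)
  assume "\<not> ?thesis"
  then have "\<forall>z\<in>K. \<exists>x\<in>K. u z < u x" by (meson not_le)
  then obtain b where b: "\<And>z. z \<in> K \<Longrightarrow> b z \<in> K \<and> u z < u (b z)" by metis
  have "\<exists>U. open U \<and> z \<in> U \<and> (\<forall>y\<in>U. u y < u (b z))" if "z \<in> K" for z
    using u b[OF that] unfolding upper_semicontinuous_def eventually_nhds by blast
  then obtain U where U: "\<And>z. z \<in> K \<Longrightarrow> open (U z) \<and> z \<in> U z \<and> (\<forall>y\<in>U z. u y < u (b z))"
    by metis
  then obtain F where F: "F \<subseteq> K" "finite F" "K \<subseteq> (\<Union>z\<in>F. U z)"
    using compactE_image[OF \<open>compact K\<close>, of K U] by (metis UN_I subsetI)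
  with \<open>K \<noteq> {}\<close> have "F \<noteq> {}" by auto
  \<comment> \<open>The largest of the finitely many values \<open>u (b z)\<close> is taken at a
    point \<open>b w\<close> of \<open>K\<close>. Some \<open>U z\<close> of the subcover contains
    that point, which forces a larger value \<open>u (b z)\<close>.\<close>
  define M where "M = Max ((\<lambda>z. u (b z)) ` F)"
  have "M \<in> (\<lambda>z. u (b z)) ` F" unfolding M_def using F(2) \<open>F \<noteq> {}\<close> by (intro Max_in) auto
  then obtain w where w: "w \<in> F" "M = u (b w)" by blast
  with F(1) b have "b w \<in> K" by blast
  with F(3) obtain z where "z \<in> F" "b w \<in> U z" by blast
  then have "u (b w) < u (b z)" using U F(1) by blast
  moreover have "u (b z) \<le> M" unfolding M_def using F(2) \<open>z \<in> F\<close> by (intro Max_ge) auto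
  ultimately show False using w(2) by simp
qed

text \<open>The fibre over \<open>x\<close> is closed in a compact space, so the supremum over a
  nonempty fibre is attained; it reaches \<alpha> exactly when some preimage of \<open>x\<close>
  does.\<close>

lemma level_set_fuzzy_extension:
  fixes f :: "'a::t1_space \<Rightarrow> 'a"
  assumes "compact (UNIV :: 'a set)" "continuous_on UNIV f" "upper_semicontinuous u" "\<alpha> > 0"
  shows "level_set (fuzzy_extension f u) \<alpha> = f ` level_set u \<alpha>"
proof -
  have "fuzzy_extension f u x \<ge> \<alpha> \<longleftrightarrow> x \<in> f ` {z. u z \<ge> \<alpha>}" for x
  proof (cases "f -` {x} = {}")
    \<comment> \<open>Over an empty fibre the extension has the default value 0, which is below
      \<alpha>.\<close>
    case True
    then show ?thesis using \<open>\<alpha> > 0\<close> by (auto simp: fuzzy_extension_def)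
  next
    case False
    have "closed (f -` {x})" using assms(2) by (intro closed_vimage) auto
    then have "compact (f -` {x})" using compact_Int_closed[OF assms(1)] by simp
    then obtain z where z: "z \<in> f -` {x}" "\<And>y. y \<in> f -` {x} \<Longrightarrow> u y \<le> u z"
      using upper_semicontinuous_attains_sup[OF assms(3) _ False] by blast
    then have "(SUP y\<in>f -` {x}. u y) = u z" by (intro cSup_eq_maximum) auto
    then have "fuzzy_extension f u x = u z" using False by (simp add: fuzzy_extension_def)
    then show ?thesis using z by force
  qed
  then show ?thesis using \<open>\<alpha> > 0\<close> by (auto simp: level_set_def)
qed

section \<open>Transport of chains\<close>

lemma is_chain_level_set:
  fixes f :: "nat \<Rightarrow> 'a::metric_space \<Rightarrow> 'a"
  assumes "compact (UNIV :: 'a set)" "\<And>i. continuous_on UNIV (f i)" "\<alpha> \<in> {0<..1}"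
    and c: "is_chain fuzzy_space fuzzy_metric (\<lambda>i. fuzzy_extension (f i)) e m c u v"
  shows "is_chain compact_hyperspace hausdorff_metric (\<lambda>i. image (f i)) e m
    (\<lambda>i. level_set (c i) \<alpha>) (level_set u \<alpha>) (level_set v \<alpha>)"
proof -
  have mem: "level_set (c i) \<beta> \<in> compact_hyperspace" "upper_semicontinuous (c i)"
    if "i \<le> m" "\<beta> \<in> {0..1}" for i \<beta>
    using c that unfolding is_chain_def fuzzy_space_def by auto
  have "hausdorff_metric (f i ` level_set (c i) \<alpha>) (level_set (c (Suc i)) \<alpha>) < e" if "i < m" for i
  proof -
    have usc: "upper_semicontinuous (c i)" using mem(2)[of i 1] that by simp
    note image = level_set_fuzzy_extension[OF assms(1,2) usc]
    \<comment> \<open>By \<open>image\<close>, the level set at 1 of the extension is an image of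
      the first of these sets, hence nonempty too.\<close>
    have ne: "level_set (c i) 1 \<noteq> {}" "level_set (c (Suc i)) 1 \<noteq> {}"
      using mem(1)[of i 1] mem(1)[of "Suc i" 1] that by (auto simp: compact_hyperspace_def)
    have "hausdorff_metric (level_set (fuzzy_extension (f i) (c i)) \<alpha>) (level_set (c (Suc i)) \<alpha>)
        \<le> fuzzy_metric (fuzzy_extension (f i) (c i)) (c (Suc i))"
      using ne assms(3)
      by (intro hausdorff_metric_le_fuzzy_metric compact_imp_bounded[OF assms(1)]) (simp_all add: image)
    also have "\<dots> < e" using c that by (simp add: is_chain_def)
    finally show ?thesis using assms(3) by (simp add: image)
  qed
  then show ?thesis using c mem(1) assms(3) by (auto simp: is_chain_def)
qed

text \<open>The starting point can be prescribed, but the end is only known to lie in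
  \<open>B\<close>; a singleton \<open>B\<close> then determines it.\<close>

lemma is_chain_select:
  fixes f :: "nat \<Rightarrow> 'a::metric_space \<Rightarrow> 'a"
  assumes "bounded (UNIV :: 'a set)" "x \<in> A"
    and c: "is_chain compact_hyperspace hausdorff_metric (\<lambda>i. image (f i)) e m c A B"
  obtains y p where "y \<in> B" "is_chain UNIV dist f e m p x y"
proof -
  have "\<exists>b. b \<in> c (Suc i) \<and> dist (f i a) b < e" if "i < m" "a \<in> c i" for i a
  proof -
    have "hausdorff_metric (f i ` c i) (c (Suc i)) < e" "c (Suc i) \<noteq> {}"
      using c that(1) by (auto simp: is_chain_def compact_hyperspace_def)
    then show ?thesis using that(2) hausdorff_metric_lessE[OF assms(1)] by (metis imageI)
  qed
  then obtain s where s: "\<And>i a. i < m \<Longrightarrow> a \<in> c i \<Longrightarrow> s i a \<in> c (Suc i) \<and> dist (f i a) (s i a) < e"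
    by metis
  \<comment> \<open>The recursor passes the time index to \<open>s\<close>, so each point is chosen
    from the next set, close to the image of the preceding point under the map of that time.\<close>
  define p where "p = rec_nat x s"
  have p: "p 0 = x" "p (Suc i) = s i (p i)" for i by (simp_all add: p_def)
  have mem: "p i \<in> c i" if "i \<le> m" for i
    using that
  proof (induction i)
    case 0
    then show ?case using p c \<open>x \<in> A\<close> by (simp add: is_chain_def)
  next
    case (Suc i)
    then show ?case using p s by simp
  qed
  have "is_chain UNIV dist f e m p x (p m)"
    using c p s mem by (simp add: is_chain_def)
  moreover have "p m \<in> B" using mem[of m] c by (simp add: is_chain_def)
  ultimately show ?thesis using that by blast
qed

theorem theorem3p1:
  fixes f :: "nat \<Rightarrow> 'a::metric_space \<Rightarrow> 'a" and n :: nat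
  assumes "compact (UNIV :: 'a set)"
    and "\<And>i. continuous_on UNIV (f i)"
    and "n \<ge> 1"
  shows "(chain_weakly_mixing n fuzzy_space fuzzy_metric (\<lambda>i. fuzzy_extension (f i)) \<longrightarrow>
          chain_weakly_mixing n compact_hyperspace hausdorff_metric (\<lambda>i. image (f i))) \<and>
         (chain_weakly_mixing n compact_hyperspace hausdorff_metric (\<lambda>i. image (f i)) \<longrightarrow>
          chain_weakly_mixing n (UNIV :: 'a set) dist f)"
  unfolding chain_weakly_mixing_iff[OF assms(3)]
proof (intro conjI impI allI)
  fix A B :: "nat \<Rightarrow> 'a set" and e :: real
  assume mixing: "\<forall>u v e. (\<forall>j<n. u j \<in> fuzzy_space \<and> v j \<in> fuzzy_space) \<longrightarrow> e > 0 \<longrightarrow>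
      (\<exists>m c. \<forall>j<n. is_chain fuzzy_space fuzzy_metric (\<lambda>i. fuzzy_extension (f i)) e m
        (c j) (u j) (v j))"
    and AB: "\<forall>j<n. A j \<in> compact_hyperspace \<and> B j \<in> compact_hyperspace" and "e > 0"
  \<comment> \<open>Indicators serve as endpoints because cutting them at level 1 returns
    \<open>A j\<close> and \<open>B j\<close>.\<close>
  have "\<forall>j<n. indicator (A j) \<in> fuzzy_space \<and> indicator (B j) \<in> fuzzy_space"
    using AB indicator_in_fuzzy_space by blast
  then obtain m c where c: "\<And>j. j < n \<Longrightarrow>
      is_chain fuzzy_space fuzzy_metric (\<lambda>i. fuzzy_extension (f i)) e m
        (c j) (indicator (A j)) (indicator (B j))"
    using mixing[rule_format, of "\<lambda>j. indicator (A j)" "\<lambda>j. indicator (B j)" e] \<open>e > 0\<close> by blast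
  have "is_chain compact_hyperspace hausdorff_metric (\<lambda>i. image (f i)) e m
      (\<lambda>i. level_set (c j i) 1) (A j) (B j)" if "j < n" for j
  proof -
    have "closed (A j)" "closed (B j)"
      using AB that by (auto simp: compact_hyperspace_def compact_imp_closed)
    then show ?thesis
      using is_chain_level_set[OF assms(1,2) _ c[OF that], of 1] by (simp add: level_set_indicator)
  qed
  then show "\<exists>m c. \<forall>j<n. is_chain compact_hyperspace hausdorff_metric (\<lambda>i. image (f i)) e m
      (c j) (A j) (B j)"
    by (intro exI[of _ m] exI[of _ "\<lambda>j i. level_set (c j i) 1"]) blast
next
  fix x y :: "nat \<Rightarrow> 'a" and e :: real
  assume mixing: "\<forall>A B e. (\<forall>j<n. A j \<in> compact_hyperspace \<and> B j \<in> compact_hyperspace) \<longrightarrow> e > 0 \<longrightarrow>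
      (\<exists>m c. \<forall>j<n. is_chain compact_hyperspace hausdorff_metric (\<lambda>i. image (f i)) e m
        (c j) (A j) (B j))"
    and "e > 0"
  have "\<forall>j<n. {x j} \<in> compact_hyperspace \<and> {y j} \<in> compact_hyperspace"
    by (simp add: compact_hyperspace_def)
  then obtain m c where c: "\<And>j. j < n \<Longrightarrow>
      is_chain compact_hyperspace hausdorff_metric (\<lambda>i. image (f i)) e m (c j) {x j} {y j}"
    using mixing[rule_format, of "\<lambda>j. {x j}" "\<lambda>j. {y j}" e] \<open>e > 0\<close> by blast
  \<comment> \<open>The selected endpoint lies in \<open>{y j}\<close>, so it is \<open>y j\<close>.
    The length \<open>m\<close> was fixed before \<open>j\<close>, so all coordinates keep
    it.\<close>
  have "\<exists>p. is_chain UNIV dist f e m p (x j) (y j)" if "j < n" for j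
    using is_chain_select[OF compact_imp_bounded[OF assms(1)] _ c[OF that], of "x j"] by blast
  then show "\<exists>m c. \<forall>j<n. is_chain UNIV dist f e m (c j) (x j) (y j)"
    by metis
qed

end
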